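(* Let $D\ge 0$ be a constant with the following property: for every planar triangle-free graph $H$, every set $S$ of vertices of $H$ such that the distance between every two vertices of $S$ is at least $D$, and every function $\psi:S\to\{1,2,3\}$, the function $\psi$ extends to a $3$-coloring of $H$. (Such a constant $D$ exists.) If $G$ is an $n$-vertex planar triangle-free graph of maximum degree at most $\Delta$, then $G$ has at least $\left(3^{1/\Delta^D}\right)^n$ distinct $3$-colorings.
   Context: Graphs are finite and simple. A $3$-coloring is a proper vertex coloring with colors $\{1,2,3\}$. The distance between two vertices is the length of a shortest path between them, and "every two vertices" refers to pairs of distinct vertices.
   Formalization: The formal theorem assumes Δ ≥ 2: for Δ = 1 the bound would be 3^n, which fails for the single edge K_2 (6 < 9 colorings), and for Δ = 0 the exponent 1/Δ^D is undefined. The existence of D is taken as background and is not proved. *)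

theory Defs
  imports
    "HOL-Analysis.Analysis"
    "Graph_Theory.Pair_Digraph"
    "Graph_Theory.Shortest_Path"
begin

text \<open>
  A finite simple graph is a \<^locale>\<open>pair_graph\<close>: a finite loopless digraph without parallel arcs
  whose arc relation is symmetric, so that an undirected edge \<open>uv\<close> is the pair of arcs
  \<open>(u, v)\<close>, \<open>(v, u)\<close>, and the degree of a vertex is its out-degree.
\<close>

definition triangle_free :: "'a pair_pre_digraph \<Rightarrow> bool" where
  "triangle_free G \<longleftrightarrow>
     \<not> (\<exists>u v w. (u, v) \<in> parcs G \<and> (v, w) \<in> parcs G \<and> (w, u) \<in> parcs G)"

text \<open>
  A drawing without crossings: vertices are distinct points \<open>p v\<close> of the plane, and the edge \<open>uv\<close>
  is an arc \<open>\<gamma> {u, v}\<close>. Indexing by the unordered pair gives both arcs of an edge the same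
  curve; its orientation is left open. An edge meets the vertex points only at its own ends, and
  two different edges meet at most at common ends.
\<close>

definition plane_drawing ::
  "'a pair_pre_digraph \<Rightarrow> ('a \<Rightarrow> complex) \<Rightarrow> ('a set \<Rightarrow> real \<Rightarrow> complex) \<Rightarrow> bool" where
  "plane_drawing G p \<gamma> \<longleftrightarrow>
     inj_on p (pverts G) \<and>
     (\<forall>(u, v) \<in> parcs G.
        arc (\<gamma> {u, v}) \<and>
        {pathstart (\<gamma> {u, v}), pathfinish (\<gamma> {u, v})} = {p u, p v} \<and>
        path_image (\<gamma> {u, v}) \<inter> p ` pverts G = {p u, p v}) \<and>
     (\<forall>(u, v) \<in> parcs G. \<forall>(x, y) \<in> parcs G. {u, v} \<noteq> {x, y} \<longrightarrow>
        path_image (\<gamma> {u, v}) \<inter> path_image (\<gamma> {x, y}) \<subseteq> p ` ({u, v} \<inter> {x, y}))"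

definition planar :: "'a pair_pre_digraph \<Rightarrow> bool" where
  "planar G \<longleftrightarrow> (\<exists>p \<gamma>. plane_drawing G p \<gamma>)"

text \<open>Unit arc costs make the cost of a walk its length; vertices in different components have
  distance \<open>\<infinity>\<close>.\<close>

definition graph_dist :: "'a pair_pre_digraph \<Rightarrow> 'a \<Rightarrow> 'a \<Rightarrow> ereal" where
  "graph_dist G u v = wf_digraph.\<mu> (with_proj G) (\<lambda>_. 1) u v"

text \<open>Colorings are extensional functions (\<open>undefined\<close> off the vertex set), so that the
  cardinality of this set counts maps on the vertices.\<close>

definition three_colorings :: "'a pair_pre_digraph \<Rightarrow> ('a \<Rightarrow> nat) set" where
  "three_colorings G =
     {f \<in> pverts G \<rightarrow>\<^sub>E {1, 2, 3}. \<forall>(u, v) \<in> parcs G. f u \<noteq> f v}"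

text \<open>The vertices of \<open>H\<close> are natural numbers, which is no restriction since \<open>H\<close> is finite.\<close>

definition precoloring_extension_const :: "real \<Rightarrow> bool" where
  "precoloring_extension_const D \<longleftrightarrow>
     (\<forall>(H :: nat pair_pre_digraph) S (\<psi> :: nat \<Rightarrow> nat).
        pair_graph H \<and> planar H \<and> triangle_free H \<and>
        S \<subseteq> pverts H \<and>
        (\<forall>u\<in>S. \<forall>v\<in>S. u \<noteq> v \<longrightarrow> ereal D \<le> graph_dist H u v) \<and>
        \<psi> \<in> S \<rightarrow> {1, 2, 3} \<longrightarrow>
        (\<exists>\<phi> \<in> three_colorings H. \<forall>v\<in>S. \<phi> v = \<psi> v))"

end

theory Submission
  imports Defs
begin

text \<open>
  A maximal set \<open>S\<close> of vertices with pairwise distances at least \<open>D\<close> gives \<open>3 ^ |S|\<close> colorings, one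
  for each precoloring of \<open>S\<close>. By maximality the balls of radius \<open>r < D\<close> around \<open>S\<close> cover the graph, so
  it remains to see that such a ball has at most \<open>\<Delta> powr D\<close> vertices. This fails for small radii, but
  \<open>D > 3\<close> is automatic: in a 5-cycle with a pendant vertex at each of its vertices, the
  pendant vertices have pairwise distance at least 3, and giving all of them the color 3 leaves only
  two colors for the odd cycle. For an integer \<open>r \<ge> 3\<close> the ball has at most
  \<open>1 + \<Delta> + \<Delta> (\<Delta> - 1) + \<dots> + \<Delta> (\<Delta> - 1) ^ (r - 1) \<le> \<Delta> ^ r\<close> vertices.
\<close>

section \<open>Balls\<close>

text \<open>Balls have natural radii and grow by out-neighbours, so that their sizes can be
  estimated layer by layer. The link to \<open>graph_dist\<close> is
  \<open>graph_dist_lessD\<close>.\<close>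

primrec gball :: "'a pair_pre_digraph \<Rightarrow> 'a \<Rightarrow> nat \<Rightarrow> 'a set" where
  "gball G v 0 = {v}"
| "gball G v (Suc k) = gball G v k \<union> parcs G `` gball G v k"

lemma gball_mono: "i \<le> j \<Longrightarrow> gball G v i \<subseteq> gball G v j"
  by (induction rule: dec_induct) auto

text \<open>The recursion extends a walk at its far end; here it is extended at the centre, as
  reversing a walk and induction on a list of arcs require.\<close>

lemma gball_Suc_left:
  assumes "(u, v) \<in> parcs G" "w \<in> gball G v k"
  shows "w \<in> gball G u (Suc k)"
  using assms(2)
proof (induction k arbitrary: w)
  case 0
  then show ?case using assms(1) by auto
next
  case (Suc k)
  from Suc.prems consider "w \<in> gball G v k" | x where "x \<in> gball G v k" "(x, w) \<in> parcs G"
    by auto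
  then show ?case
  proof cases
    case 1
    from Suc.IH[OF 1] show ?thesis unfolding gball.simps(2)[of G u "Suc k"] by blast
  next
    case 2
    from Suc.IH[OF 2(1)] 2(2) show ?thesis unfolding gball.simps(2)[of G u "Suc k"] by blast
  qed
qed

lemma finite_gball: "finite (parcs G) \<Longrightarrow> finite (gball G v k)"
  by (induction k) auto

text \<open>The last arc of a walk from \<open>v\<close> to \<open>w\<close>, reversed, is the first
  arc of a walk back.\<close>

lemma gball_sym:
  assumes "symmetric (with_proj G)" "w \<in> gball G v k"
  shows "v \<in> gball G w k"
  using assms(2)
proof (induction k arbitrary: w)
  case (Suc k)
  from Suc.prems consider "w \<in> gball G v k" | x where "x \<in> gball G v k" "(x, w) \<in> parcs G"
    by auto
  then show ?case
  proof cases
    case 1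
    from Suc.IH[OF 1] show ?thesis by simp
  next
    case 2
    then have "(w, x) \<in> parcs G"
      using assms(1) by (auto simp: symmetric_def dest: symD)
    then show ?thesis using Suc.IH[OF 2(1)] by (rule gball_Suc_left)
  qed
qed simp

text \<open>\<open>graph_dist\<close> is an infimum of walk costs, so a value below \<open>D\<close>
  is witnessed by a walk of cost below \<open>D\<close>. With unit costs its length serves as the
  radius \<open>k\<close>.\<close>

lemma graph_dist_lessD:
  assumes "pair_wf_digraph G" "graph_dist G u v < ereal D"
  shows "\<exists>k. real k < D \<and> v \<in> gball G u k"
proof -
  interpret pair_wf_digraph G by fact
  obtain p where p: "awalk u p v" and cost: "awalk_cost (\<lambda>_. 1) p < D"
    using assms(2) unfolding graph_dist_def \<mu>_def by (auto simp: INF_less_iff)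
  have "awalk_cost (\<lambda>_. 1) p = real (length p)" for p :: "('a \<times> 'a) list"
    by (induction p) (auto simp: awalk_cost_def)
  moreover have "v \<in> gball G u (length p)"
    using p
  proof (induction p arbitrary: u)
    case Nil
    then show ?case by (simp add: awalk_Nil_iff)
  next
    case (Cons e p)
    then show ?case using gball_Suc_left[of u "snd e" G v "length p"]
      by (cases e) (auto simp: awalk_Cons_iff)
  qed
  ultimately show ?thesis using cost by metis
qed

text \<open>A vertex outside a ball but adjacent to it has at most \<open>\<Delta> - 1\<close>
  neighbours outside that ball. Only the centre is allowed \<open>\<Delta>\<close> new
  neighbours.\<close>

lemma card_gball_layer:
  assumes "finite (parcs G)" "symmetric (with_proj G)"
    and deg: "\<And>w. card (parcs G `` {w}) \<le> \<Delta>"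
  shows "card (gball G v (Suc k) - gball G v k) \<le> \<Delta> * (\<Delta> - 1) ^ k"
proof (induction k)
  case 0
  have "card (parcs G `` {v} - {v}) \<le> card (parcs G `` {v})"
    using assms(1) by (intro card_mono) auto
  then show ?case using deg[of v] by (simp add: Un_Diff)
next
  case (Suc k)
  let ?L = "gball G v (Suc k) - gball G v k"
  have fin: "finite (gball G v j)" for j
    using assms(1) by (rule finite_gball)
  \<comment> \<open>All out-neighbours of \<open>gball G v k\<close> lie in the next ball already,
    so a new vertex can be reached only from the last layer \<open>?L\<close>.\<close>
  have "gball G v (Suc (Suc k)) - gball G v (Suc k)
      \<subseteq> (\<Union>x\<in>?L. parcs G `` {x} - gball G v k)"
    by auto
  then have "card (gball G v (Suc (Suc k)) - gball G v (Suc k))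
      \<le> card (\<Union>x\<in>?L. parcs G `` {x} - gball G v k)"
    using fin[of "Suc k"] assms(1) by (intro card_mono) auto
  also have "\<dots> \<le> (\<Sum>x\<in>?L. card (parcs G `` {x} - gball G v k))"
    using fin by (intro card_UN_le finite_Diff)
  also have "\<dots> \<le> (\<Sum>x\<in>?L. \<Delta> - 1)"
  proof (rule sum_mono)
    fix x assume "x \<in> ?L"
    then obtain y where y: "y \<in> gball G v k" "(y, x) \<in> parcs G" by auto
    then have "(x, y) \<in> parcs G"
      using assms(2) by (auto simp: symmetric_def dest: symD)
    with y have "card (parcs G `` {x} - gball G v k) < card (parcs G `` {x})"
      using assms(1) by (intro psubset_card_mono) auto
    then show "card (parcs G `` {x} - gball G v k) \<le> \<Delta> - 1"
      using deg[of x] by linarith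
  qed
  also have "\<dots> = card ?L * (\<Delta> - 1)" by simp
  also have "\<dots> \<le> \<Delta> * (\<Delta> - 1) ^ k * (\<Delta> - 1)"
    using Suc.IH by (rule mult_right_mono) simp
  finally show ?case by (simp add: mult_ac)
qed

text \<open>Radius 2 is not enough: a 5-cycle is a ball of radius 2 with more than \<open>2\<^sup>2\<close> vertices.\<close>

lemma card_gball_le_power:
  assumes "finite (parcs G)" "symmetric (with_proj G)"
    and deg: "\<And>w. card (parcs G `` {w}) \<le> \<Delta>"
    and "\<Delta> \<ge> 2" "r \<ge> 3"
  shows "card (gball G v r) \<le> \<Delta> ^ r"
proof -
  obtain d where d: "\<Delta> = Suc d" "d \<ge> 1" using \<open>\<Delta> \<ge> 2\<close> by (cases \<Delta>) auto
  have fin: "finite (gball G v j)" for j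
    using assms(1) by (rule finite_gball)
  have step: "card (gball G v (Suc k)) \<le> card (gball G v k) + \<Delta> * d ^ k" for k
  proof -
    have "card (gball G v (Suc k)) = card (gball G v k) + card (gball G v (Suc k) - gball G v k)"
      using fin[of k] fin[of "Suc k"]
      by (subst card_Un_disjoint[symmetric]) (auto intro!: arg_cong[where f = card])
    then show ?thesis using card_gball_layer[OF assms(1-3), of v k] d by simp
  qed
  have "card (gball G v 3) \<le> 1 + \<Delta> + \<Delta> * d + \<Delta> * d ^ 2"
    using step[of 0] step[of 1] step[of 2] by (simp add: numeral_3_eq_3 numeral_2_eq_2 del: gball.simps(2))
  \<comment> \<open>With \<open>\<Delta> = d + 1\<close> the right side exceeds the left by
    \<open>d ^ 2 + d - 1\<close>, which is positive because \<open>d \<ge> 1\<close>.\<close>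
  also have "\<dots> \<le> \<Delta> ^ 3"
    using d by (simp add: power3_eq_cube power2_eq_square algebra_simps)
  finally have base: "card (gball G v 3) \<le> \<Delta> ^ 3" .
  show ?thesis
    using \<open>r \<ge> 3\<close>
  proof (induction r rule: dec_induct)
    case (step k)
    \<comment> \<open>Since \<open>\<Delta> ^ Suc k = \<Delta> ^ k + d * \<Delta> ^ k\<close>, it
      suffices that \<open>\<Delta> * d ^ k \<le> d * \<Delta> ^ k\<close>; one factor
      \<open>d\<close> is kept and the others are raised to \<open>\<Delta>\<close>.\<close>
    obtain m where m: "k = Suc m" using step.hyps by (cases k) auto
    have "\<Delta> * d ^ k = \<Delta> * d * d ^ m" using m by simp
    also have "\<dots> \<le> \<Delta> * d * \<Delta> ^ m" using d by (intro mult_left_mono power_mono) auto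
    also have "\<dots> = d * \<Delta> ^ k" using m by simp
    finally show ?case
      using \<open>card (gball G v (Suc k)) \<le> card (gball G v k) + \<Delta> * d ^ k\<close> step.IH d by simp
  qed (rule base)
qed


section \<open>The radius exceeds 3\<close>

text \<open>Curves are indexed by unordered pairs, so \<open>Min\<close> and \<open>Max\<close>
  serve to orient each segment. What remains to be checked for a straight-line drawing concerns
  segments only.\<close>

lemma plane_drawing_straight:
  fixes p :: "nat \<Rightarrow> complex"
  assumes "inj_on p (pverts G)"
    and "\<And>u v. (u, v) \<in> parcs G \<Longrightarrow> u \<noteq> v \<and> u \<in> pverts G \<and> v \<in> pverts G"
    and "\<And>u v w. (u, v) \<in> parcs G \<Longrightarrow> w \<in> pverts G \<Longrightarrow> p w \<in> closed_segment (p u) (p v) \<Longrightarrow> w \<in> {u, v}"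
    and "\<And>u v x y. (u, v) \<in> parcs G \<Longrightarrow> (x, y) \<in> parcs G \<Longrightarrow> {u, v} \<noteq> {x, y} \<Longrightarrow>
      closed_segment (p u) (p v) \<inter> closed_segment (p x) (p y) \<subseteq> p ` ({u, v} \<inter> {x, y})"
  shows "plane_drawing G p (\<lambda>e. linepath (p (Min e)) (p (Max e)))"
proof -
  let ?\<gamma> = "\<lambda>e. linepath (p (Min e)) (p (Max e))"
  have mm: "Min {u, v} = u \<and> Max {u, v} = v \<or> Min {u, v} = v \<and> Max {u, v} = u" for u v :: nat
    by (auto simp: min_def max_def)
  have seg: "path_image (?\<gamma> {u, v}) = closed_segment (p u) (p v)" for u v
    using mm[of u v] by (auto simp: closed_segment_commute)
  have ends: "{pathstart (?\<gamma> {u, v}), pathfinish (?\<gamma> {u, v})} = {p u, p v}" for u v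
    using mm[of u v] by auto
  have arc: "arc (?\<gamma> {u, v})" if "(u, v) \<in> parcs G" for u v
  proof -
    have "p u \<noteq> p v" using assms(1) assms(2)[OF that] by (auto dest: inj_onD)
    then show ?thesis using mm[of u v] by (auto intro: arc_linepath)
  qed
  have meet: "closed_segment (p u) (p v) \<inter> p ` pverts G = {p u, p v}" if "(u, v) \<in> parcs G" for u v
    using assms(2,3)[OF that] by auto
  show ?thesis
    unfolding plane_drawing_def
  proof (intro conjI ballI case_prodI2 impI)
    fix e u v e' x y
    assume "e \<in> parcs G" "e = (u, v)" "e' \<in> parcs G" "e' = (x, y)" "{u, v} \<noteq> {x, y}"
    then show "path_image (?\<gamma> {u, v}) \<inter> path_image (?\<gamma> {x, y}) \<subseteq> p ` ({u, v} \<inter> {x, y})"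
      unfolding seg by (intro assms(4)) auto
  qed (use assms(1) arc meet in \<open>simp_all only: seg ends\<close>)
qed

section \<open>The sun: a 5-cycle with a pendant vertex at each of its vertices\<close>

definition sun_edges :: "(nat \<times> nat) set" where
  "sun_edges = {(0,1), (1,2), (2,3), (3,4), (4,0), (0,5), (1,6), (2,7), (3,8), (4,9)}"

text \<open>The cycle is on 0 to 4, and \<open>i + 5\<close> is the pendant neighbour of
  \<open>i\<close>. As \<open>sun_edges\<close> holds one direction of each edge, case checks on the
  drawing involve only ten edges.\<close>

definition sun :: "nat pair_pre_digraph" where
  "sun = \<lparr>pverts = {..<10}, parcs = sun_edges \<union> sun_edges\<inverse>\<rparr>"

text \<open>The rays of the sun are placed by doubling the coordinates of a convex pentagon around 0.\<close>

definition sun_pos :: "nat \<Rightarrow> complex" where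
  "sun_pos = (!) [Complex 2 0, Complex 1 2, Complex (-2) 1, Complex (-2) (-1), Complex 1 (-2),
                  Complex 4 0, Complex 2 4, Complex (-4) 2, Complex (-4) (-2), Complex 2 (-4)]"

lemma sun_pos_simps:
  "sun_pos 0 = Complex 2 0" "sun_pos 1 = Complex 1 2" "sun_pos (Suc 0) = Complex 1 2"
  "sun_pos 2 = Complex (-2) 1"
  "sun_pos 3 = Complex (-2) (-1)" "sun_pos 4 = Complex 1 (-2)" "sun_pos 5 = Complex 4 0"
  "sun_pos 6 = Complex 2 4" "sun_pos 7 = Complex (-4) 2" "sun_pos 8 = Complex (-4) (-2)"
  "sun_pos 9 = Complex 2 (-4)"
  by (simp_all add: sun_pos_def)

lemma lessThan_10: "{..<10::nat} = {0,1,2,3,4,5,6,7,8,9}"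
  by auto

lemma parcs_sun:
  "parcs sun = {(0,1), (1,2), (2,3), (3,4), (4,0), (0,5), (1,6), (2,7), (3,8), (4,9),
                (1,0), (2,1), (3,2), (4,3), (0,4), (5,0), (6,1), (7,2), (8,3), (9,4)}"
proof -
  have "(insert (a, b) r)\<inverse> = insert (b, a) (r\<inverse>)" for a b :: nat and r
    by auto
  then show ?thesis
    unfolding sun_def sun_edges_def
    by (simp only: converse_empty Un_insert_left Un_empty_left pair_pre_digraph.simps)
qed

lemma pair_graph_sun: "pair_graph sun"
proof
  show "symmetric (with_proj sun)"
    by (simp add: symmetric_def sun_def sym_Un_converse)
qed (auto simp: sun_def sun_edges_def)

lemma triangle_free_sun: "triangle_free sun"
proof -
  have "\<forall>e\<in>parcs sun. \<forall>f\<in>parcs sun. snd e = fst f \<longrightarrow> (snd f, fst e) \<notin> parcs sun"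
    unfolding parcs_sun by simp
  then show ?thesis unfolding triangle_free_def by force
qed

lemma complex_in_closed_segmentE:
  assumes "z \<in> closed_segment a b"
  obtains t where "0 \<le> t" "t \<le> 1"
    "Re z = Re a + t * (Re b - Re a)" "Im z = Im a + t * (Im b - Im a)"
proof -
  obtain t where t: "0 \<le> t" "t \<le> 1" and z: "z = (1 - t) *\<^sub>R a + t *\<^sub>R b"
    using assms unfolding in_segment by blast
  have "Re z = Re a + t * (Re b - Re a)" "Im z = Im a + t * (Im b - Im a)"
    unfolding z by (simp_all add: algebra_simps)
  with t show thesis by (rule that)
qed

text \<open>For a concrete edge and vertex, both coordinate equations are linear in
  \<open>t\<close>, and linear arithmetic refutes them unless the vertex is an end.\<close>

lemma sun_pos_vertex:
  assumes e: "(u, v) \<in> sun_edges" and "w < 10"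
    and "sun_pos w \<in> closed_segment (sun_pos u) (sun_pos v)"
  shows "w \<in> {u, v}"
proof -
  obtain t where t: "0 \<le> t" "t \<le> 1"
    "Re (sun_pos w) = Re (sun_pos u) + t * (Re (sun_pos v) - Re (sun_pos u))"
    "Im (sun_pos w) = Im (sun_pos u) + t * (Im (sun_pos v) - Im (sun_pos u))"
    using assms(3) by (rule complex_in_closed_segmentE)
  have w: "w \<in> {0,1,2,3,4,5,6,7,8,9}" using assms(2) lessThan_10 by blast
  show ?thesis
    using w e[unfolded sun_edges_def]
    by (elim insertE emptyE; simp only: prod.inject; elim conjE;
        insert t; simp add: sun_pos_simps; linarith?)
qed

text \<open>For two concrete edges, equating the coordinates of \<open>z\<close> gives a linear
  system in \<open>t\<close> and \<open>s\<close>: it is infeasible for disjoint edges and forces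
  \<open>z\<close> to be the common end otherwise. Distinct pairs in \<open>sun_edges\<close> are
  distinct edges.\<close>

lemma sun_pos_cross:
  assumes e: "(u, v) \<in> sun_edges" and e': "(x, y) \<in> sun_edges" and neq: "(u, v) \<noteq> (x, y)"
    and "z \<in> closed_segment (sun_pos u) (sun_pos v)" "z \<in> closed_segment (sun_pos x) (sun_pos y)"
  shows "z \<in> sun_pos ` ({u, v} \<inter> {x, y})"
proof -
  obtain t where t: "0 \<le> t" "t \<le> 1"
    "Re z = Re (sun_pos u) + t * (Re (sun_pos v) - Re (sun_pos u))"
    "Im z = Im (sun_pos u) + t * (Im (sun_pos v) - Im (sun_pos u))"
    using assms(4) by (rule complex_in_closed_segmentE)
  obtain s where s: "0 \<le> s" "s \<le> 1"
    "Re z = Re (sun_pos x) + s * (Re (sun_pos y) - Re (sun_pos x))"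
    "Im z = Im (sun_pos x) + s * (Im (sun_pos y) - Im (sun_pos x))"
    using assms(5) by (rule complex_in_closed_segmentE)
  show ?thesis
    using e[unfolded sun_edges_def] e'[unfolded sun_edges_def]
    by (elim insertE emptyE; simp only: prod.inject; elim conjE;
        insert t s neq; simp add: sun_pos_simps complex_eq_iff; linarith?)
qed

lemma planar_sun: "planar sun"
proof -
  have "plane_drawing sun sun_pos (\<lambda>e. linepath (sun_pos (Min e)) (sun_pos (Max e)))"
  proof (rule plane_drawing_straight)
    show "inj_on sun_pos (pverts sun)"
      by (simp add: sun_def lessThan_10 sun_pos_simps)
    show "u \<noteq> v \<and> u \<in> pverts sun \<and> v \<in> pverts sun" if "(u, v) \<in> parcs sun" for u v
      using that by (auto simp: sun_def sun_edges_def)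
  next
    fix u v w
    assume "(u, v) \<in> parcs sun" "w \<in> pverts sun"
      "sun_pos w \<in> closed_segment (sun_pos u) (sun_pos v)"
    then show "w \<in> {u, v}"
      using sun_pos_vertex[of u v w] sun_pos_vertex[of v u w]
      by (auto simp: sun_def closed_segment_commute)
  next
    fix u v x y
    assume "(u, v) \<in> parcs sun" "(x, y) \<in> parcs sun" "{u, v} \<noteq> {x, y}"
    then show "closed_segment (sun_pos u) (sun_pos v) \<inter> closed_segment (sun_pos x) (sun_pos y)
        \<subseteq> sun_pos ` ({u, v} \<inter> {x, y})"
      \<comment> \<open>Either arc may be the reverse of a listed one, hence four instances.\<close>
      using sun_pos_cross[of u v x y] sun_pos_cross[of v u x y]
        sun_pos_cross[of u v y x] sun_pos_cross[of v u y x]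
      by (auto simp: sun_def closed_segment_commute insert_commute simp del: image_Int)
  qed
  then show ?thesis unfolding planar_def by blast
qed

text \<open>From a pendant vertex the first step leads to its cycle vertex, and the second goes back
  or along the cycle.\<close>

lemma sun_rays_far:
  assumes "u \<in> {5..9}" "v \<in> {5..9}" "v \<in> gball sun u 2"
  shows "u = v"
  using assms
  by (auto simp: numeral_2_eq_2 sun_def sun_edges_def Image_iff)

lemma sun_not_extendable:
  assumes "\<phi> \<in> three_colorings sun" "\<And>v. v \<in> {5..9} \<Longrightarrow> \<phi> v = 3"
  shows False
proof -
  have edge: "\<phi> u \<noteq> \<phi> v" if "(u, v) \<in> sun_edges" for u v
  proof -
    have "(u, v) \<in> parcs sun" using that by (simp add: sun_def)
    then show ?thesis using assms(1) unfolding three_colorings_def by blast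
  qed
  have two: "\<phi> u = 1 \<or> \<phi> u = 2" if "u < 5" for u
  proof -
    have "u \<in> {0,1,2,3,4}" using that by auto
    then have "(u, u + 5) \<in> sun_edges"
      unfolding sun_edges_def by (elim insertE emptyE) simp_all
    then have "\<phi> u \<noteq> 3" using edge[of u "u + 5"] assms(2)[of "u + 5"] that by simp
    moreover have "\<phi> u \<in> {1, 2, 3}"
      using assms(1) that PiE_mem[of \<phi> "pverts sun" "\<lambda>_. {1, 2, 3}" u]
      by (simp add: three_colorings_def sun_def)
    ultimately show ?thesis by blast
  qed
  \<comment> \<open>Two colors would have to alternate around a cycle of odd length.\<close>
  have odd: False if "a \<noteq> b" "b \<noteq> c" "c \<noteq> d" "d \<noteq> e" "e \<noteq> a"
    "a = 1 \<or> a = 2" "b = 1 \<or> b = 2" "c = 1 \<or> c = 2" "d = 1 \<or> d = 2" "e = 1 \<or> e = 2"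
    for a b c d e :: nat
    using that by metis
  show False
    by (rule odd[of "\<phi> 0" "\<phi> 1" "\<phi> 2" "\<phi> 3" "\<phi> 4"]; (rule edge two; simp add: sun_edges_def))
qed

text \<open>If \<open>D \<le> 3\<close>, the pendant vertices of \<open>sun\<close> would be far
  enough apart for the precoloring with constant value 3 to extend. The strict inequality is what
  makes the radius 3 available below \<open>D\<close>.\<close>

lemma precoloring_extension_const_gt_3:
  assumes "precoloring_extension_const D"
  shows "D > 3"
proof (rule ccontr)
  assume "\<not> D > 3"
  interpret pair_graph sun by (rule pair_graph_sun)
  have "ereal D \<le> graph_dist sun u v" if "u \<in> {5..9}" "v \<in> {5..9}" "u \<noteq> v" for u v
  proof (rule ccontr)
    assume "\<not> ereal D \<le> graph_dist sun u v"
    then obtain k where "real k < D" "v \<in> gball sun u k"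
      using graph_dist_lessD[OF pair_wf_digraph, of u v D] by (auto simp only: not_le)
    moreover from this have "k \<le> 2" using \<open>\<not> D > 3\<close> by linarith
    ultimately have "v \<in> gball sun u 2" using gball_mono[of k 2 sun u] by blast
    with sun_rays_far that show False by blast
  qed
  moreover have "{5..9} \<subseteq> pverts sun" by (auto simp: sun_def)
  moreover have "(\<lambda>_. 3) \<in> {5..9::nat} \<rightarrow> {1, 2, 3::nat}" by auto
  ultimately have "pair_graph sun \<and> planar sun \<and> triangle_free sun \<and> {5..9} \<subseteq> pverts sun \<and>
      (\<forall>u\<in>{5..9}. \<forall>v\<in>{5..9}. u \<noteq> v \<longrightarrow> ereal D \<le> graph_dist sun u v) \<and>
      (\<lambda>_. 3) \<in> {5..9::nat} \<rightarrow> {1, 2, 3::nat}"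
    using pair_graph_sun planar_sun triangle_free_sun by blast
  from assms[unfolded precoloring_extension_const_def, rule_format, OF this]
  show False using sun_not_extendable by blast
qed

section \<open>Counting and relabelling\<close>

lemma finite_three_colorings: "finite (pverts G) \<Longrightarrow> finite (three_colorings G)"
  unfolding three_colorings_def
  by (rule finite_subset[OF _ finite_PiE[of "pverts G" "\<lambda>_. {1, 2, 3}"]]) auto

text \<open>The counting argument is done for the vertex type \<open>nat\<close>, because
  \<open>precoloring_extension_const\<close> quantifies over graphs of that type.\<close>

lemma card_three_colorings_nat:
  fixes H :: "nat pair_pre_digraph"
  assumes D: "precoloring_extension_const D"
    and H: "pair_graph H" "planar H" "triangle_free H"
    and deg: "\<And>w. card (parcs H `` {w}) \<le> \<Delta>" and "\<Delta> \<ge> 2"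
  shows "(3 powr (1 / (real \<Delta> powr D))) ^ card (pverts H) \<le> real (card (three_colorings H))"
proof -
  interpret pair_graph H by fact
  have "D > 3" using D by (rule precoloring_extension_const_gt_3)
  \<comment> \<open>The largest integer strictly below \<open>D\<close>; walk lengths are integers,
    so a length below \<open>D\<close> is at most \<open>r\<close>.\<close>
  define r where "r = nat (\<lceil>D\<rceil> - 1)"
  have r: "3 \<le> r" "real r < D" using \<open>D > 3\<close> unfolding r_def by linarith+
  have le_r: "k \<le> r" if "real k < D" for k using that unfolding r_def by linarith
  have near: "v \<in> gball H u r" if uv: "\<not> ereal D \<le> graph_dist H u v" for u v
  proof -
    obtain k where "real k < D" "v \<in> gball H u k"
      using graph_dist_lessD[OF pair_wf_digraph uv[unfolded not_le]] by blast
    with le_r[of k] gball_mono[of k r H u] show ?thesis by blast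
  qed
  define scattered where
    "scattered S \<longleftrightarrow> S \<subseteq> pverts H \<and> (\<forall>u\<in>S. \<forall>v\<in>S. u \<noteq> v \<longrightarrow> ereal D \<le> graph_dist H u v)" for S
  have "finite {S. scattered S}"
    by (rule finite_subset[of _ "Pow (pverts H)"]) (auto simp: scattered_def pair_finite_verts)
  moreover have "scattered {}" by (simp add: scattered_def)
  ultimately obtain S where S: "scattered S" and S_max: "\<And>T. scattered T \<Longrightarrow> S \<subseteq> T \<Longrightarrow> T = S"
    using finite_has_maximal2[of "{S. scattered S}" "{}"] by auto
  have "S \<subseteq> pverts H" using S by (simp add: scattered_def)
  then have "finite S" using pair_finite_verts by (rule finite_subset)
  have "pverts H \<subseteq> (\<Union>s\<in>S. gball H s r)"
  proof
    fix u assume u: "u \<in> pverts H"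
    show "u \<in> (\<Union>s\<in>S. gball H s r)"
    proof (cases "u \<in> S")
      case True
      then show ?thesis using gball_mono[of 0 r H u] by auto
    next
      case False
      then have "\<not> scattered (insert u S)" using S_max by blast
      \<comment> \<open>\<open>scattered\<close> tests both orders of a pair. If the violated
        inequality is the one starting at \<open>u\<close>, \<open>gball_sym\<close> turns the ball
        around.\<close>
      then obtain s where "s \<in> S"
        "\<not> ereal D \<le> graph_dist H s u \<or> \<not> ereal D \<le> graph_dist H u s"
        using u S unfolding scattered_def by blast
      then show ?thesis using near gball_sym[OF sym_arcs] by blast
    qed
  qed
  then have "card (pverts H) \<le> card (\<Union>s\<in>S. gball H s r)"
    using \<open>finite S\<close> finite_gball[OF pair_finite_arcs] by (intro card_mono) auto
  also have "\<dots> \<le> (\<Sum>s\<in>S. card (gball H s r))"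
    using \<open>finite S\<close> by (rule card_UN_le)
  also have "\<dots> \<le> (\<Sum>s\<in>S. \<Delta> ^ r)"
    using card_gball_le_power[OF pair_finite_arcs sym_arcs deg \<open>\<Delta> \<ge> 2\<close> r(1)] by (intro sum_mono)
  finally have "real (card (pverts H)) \<le> real (card S) * real \<Delta> ^ r"
    by (simp flip: of_nat_power of_nat_mult)
  also have "real \<Delta> ^ r \<le> real \<Delta> powr D"
    using r(2) \<open>\<Delta> \<ge> 2\<close> by (simp flip: powr_realpow)
  finally have card_le: "real (card (pverts H)) \<le> real (card S) * real \<Delta> powr D"
    by (simp add: mult_left_mono)

  have "finite (three_colorings H)"
    using pair_finite_verts by (rule finite_three_colorings)
  \<comment> \<open>The extension property says that restriction to \<open>S\<close> reaches every
    precoloring. Extensionality of \<open>\<psi>\<close> makes the restriction equal to it also off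
    \<open>S\<close>.\<close>
  moreover have "(S \<rightarrow>\<^sub>E {1, 2, 3}) \<subseteq> (\<lambda>\<phi>. restrict \<phi> S) ` three_colorings H"
  proof
    fix \<psi> :: "nat \<Rightarrow> nat" assume \<psi>: "\<psi> \<in> S \<rightarrow>\<^sub>E {1, 2, 3}"
    then obtain \<phi> where "\<phi> \<in> three_colorings H" "\<forall>v\<in>S. \<phi> v = \<psi> v"
      using D[unfolded precoloring_extension_const_def, rule_format, of H S \<psi>] H S
      by (auto simp: scattered_def PiE_def)
    moreover from this have "\<psi> = restrict \<phi> S" using PiE_arb[OF \<psi>] by (auto simp: restrict_def)
    ultimately show "\<psi> \<in> (\<lambda>\<phi>. restrict \<phi> S) ` three_colorings H" by blast
  qed
  ultimately have "card (S \<rightarrow>\<^sub>E {1, 2, 3::nat}) \<le> card (three_colorings H)"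
    by (rule surj_card_le)
  then have "3 ^ card S \<le> card (three_colorings H)"
    using \<open>finite S\<close> by (simp add: card_PiE numeral_3_eq_3)
  then have colorings: "3 ^ card S \<le> real (card (three_colorings H))"
    by (metis of_nat_le_iff of_nat_numeral of_nat_power)

  have "(3 powr (1 / (real \<Delta> powr D))) ^ card (pverts H)
      = 3 powr (real (card (pverts H)) / real \<Delta> powr D)"
    by (simp add: powr_power)
  also have "\<dots> \<le> 3 powr real (card S)"
    using card_le \<open>\<Delta> \<ge> 2\<close> by (simp add: divide_le_eq)
  also have "\<dots> = 3 ^ card S" by (simp add: powr_realpow)
  finally show ?thesis using colorings by linarith
qed

section \<open>Transport along an injective renaming of the vertices\<close>

definition relabel :: "('a \<Rightarrow> 'b) \<Rightarrow> 'a pair_pre_digraph \<Rightarrow> 'b pair_pre_digraph" where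
  "relabel f G = \<lparr>pverts = f ` pverts G, parcs = map_prod f f ` parcs G\<rparr>"

lemma relabel_simps [simp]:
  "pverts (relabel f G) = f ` pverts G"
  "parcs (relabel f G) = map_prod f f ` parcs G"
  by (simp_all add: relabel_def)

context
  fixes f :: "'a \<Rightarrow> 'b" and G :: "'a pair_pre_digraph"
  assumes G: "pair_graph G" and inj: "inj_on f (pverts G)"
begin

interpretation pair_graph G by (rule G)

text \<open>\<open>f\<close> is injective on vertices only, so both \<open>u\<close> and
  \<open>v\<close> must be vertices for the preimage of the arc to be unique.\<close>

lemma relabel_arc_iff:
  assumes "u \<in> pverts G" "v \<in> pverts G"
  shows "(f u, f v) \<in> parcs (relabel f G) \<longleftrightarrow> (u, v) \<in> parcs G"
proof
  assume "(f u, f v) \<in> parcs (relabel f G)"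
  then obtain a b where ab: "(a, b) \<in> parcs G" "f u = f a" "f v = f b" by auto
  then have "u = a" "v = b" using assms inj by (auto dest: in_arcsD1 in_arcsD2 inj_onD)
  with ab(1) show "(u, v) \<in> parcs G" by simp
qed force

lemma pair_graph_relabel: "pair_graph (relabel f G)"
proof
  show "symmetric (with_proj (relabel f G))"
    by (auto simp: symmetric_def intro!: symI arcs_symmetric)
  show "fst e \<noteq> snd e" if e: "e \<in> parcs (relabel f G)" for e
  proof -
    obtain a b where ab: "e = (f a, f b)" "(a, b) \<in> parcs G" using e by auto
    then have "a \<in> pverts G" "b \<in> pverts G" "a \<noteq> b"
      by (auto dest: in_arcsD1 in_arcsD2 no_loops')
    with ab(1) inj show ?thesis by (auto dest: inj_onD)
  qed
qed (auto dest: in_arcsD1 in_arcsD2 simp: pair_finite_verts pair_finite_arcs)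

lemma triangle_free_relabel:
  assumes "triangle_free G"
  shows "triangle_free (relabel f G)"
  unfolding triangle_free_def
proof safe
  fix u v w
  assume uv: "(u, v) \<in> parcs (relabel f G)" and vw: "(v, w) \<in> parcs (relabel f G)"
    and wu: "(w, u) \<in> parcs (relabel f G)"
  obtain a b where ab: "u = f a" "v = f b" "a \<in> pverts G" "b \<in> pverts G"
    using uv by (auto dest: in_arcsD1 in_arcsD2)
  obtain c where "w = f c" "c \<in> pverts G"
    using vw by (auto dest: in_arcsD1 in_arcsD2)
  with ab uv vw wu have "(a, b) \<in> parcs G" "(b, c) \<in> parcs G" "(c, a) \<in> parcs G"
    by (auto simp only: relabel_arc_iff)
  with assms show False unfolding triangle_free_def by blast
qed

text \<open>The points and curves of the given drawing are reused, read through the inverse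
  \<open>g\<close> of \<open>f\<close>.\<close>

lemma planar_relabel:
  assumes "planar G"
  shows "planar (relabel f G)"
proof -
  obtain p \<gamma> where d: "plane_drawing G p \<gamma>" using assms unfolding planar_def by (elim exE)
  define g where "g = the_inv_into (pverts G) f"
  have g: "g (f v) = v" if "v \<in> pverts G" for v
    using the_inv_into_f_f[OF inj that] by (simp add: g_def)
  have "plane_drawing (relabel f G) (p \<circ> g) (\<lambda>e. \<gamma> (g ` e))"
    unfolding plane_drawing_def
  proof (intro conjI ballI case_prodI2 impI)
    show "inj_on (p \<circ> g) (pverts (relabel f G))"
      using d by (auto simp: plane_drawing_def inj_on_def g)
    have img: "(p \<circ> g) ` pverts (relabel f G) = p ` pverts G"
      by (simp add: image_image g)
    have edge: "\<exists>a b. u = f a \<and> v = f b \<and> g u = a \<and> g v = b \<and> (a, b) \<in> parcs G"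
      if uv: "(u, v) \<in> parcs (relabel f G)" for u v
    proof -
      obtain a b where "u = f a" "v = f b" "(a, b) \<in> parcs G" using uv by auto
      moreover from this have "g u = a" "g v = b" by (auto intro!: g dest: in_arcsD1 in_arcsD2)
      ultimately show ?thesis by blast
    qed
    have edge_curve: "Path_Connected.arc (\<gamma> (g ` {u, v}))"
      "{pathstart (\<gamma> (g ` {u, v})), pathfinish (\<gamma> (g ` {u, v}))} = {(p \<circ> g) u, (p \<circ> g) v}"
      "path_image (\<gamma> (g ` {u, v})) \<inter> (p \<circ> g) ` pverts (relabel f G) = {(p \<circ> g) u, (p \<circ> g) v}"
      if uv: "(u, v) \<in> parcs (relabel f G)" for u v
    proof -
      obtain a b where ab: "g u = a" "g v = b" "(a, b) \<in> parcs G"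
        using edge[OF uv] by blast
      from d[unfolded plane_drawing_def, THEN conjunct2, THEN conjunct1, THEN bspec, OF ab(3)]
      have "Path_Connected.arc (\<gamma> {a, b})"
        "{pathstart (\<gamma> {a, b}), pathfinish (\<gamma> {a, b})} = {p a, p b}"
        "path_image (\<gamma> {a, b}) \<inter> p ` pverts G = {p a, p b}"
        by (simp_all only: prod.case)
      then show "Path_Connected.arc (\<gamma> (g ` {u, v}))"
        "{pathstart (\<gamma> (g ` {u, v})), pathfinish (\<gamma> (g ` {u, v}))} = {(p \<circ> g) u, (p \<circ> g) v}"
        "path_image (\<gamma> (g ` {u, v})) \<inter> (p \<circ> g) ` pverts (relabel f G) = {(p \<circ> g) u, (p \<circ> g) v}"
        unfolding img using ab by simp_all
    qed
    fix e u v assume e: "e \<in> parcs (relabel f G)" "e = (u, v)"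
    then show "Path_Connected.arc (\<gamma> (g ` {u, v}))"
      and "{pathstart (\<gamma> (g ` {u, v})), pathfinish (\<gamma> (g ` {u, v}))} = {(p \<circ> g) u, (p \<circ> g) v}"
      and "path_image (\<gamma> (g ` {u, v})) \<inter> (p \<circ> g) ` pverts (relabel f G) = {(p \<circ> g) u, (p \<circ> g) v}"
      by (simp_all only: edge_curve)
    fix e' x y
    assume e': "e' \<in> parcs (relabel f G)" "e' = (x, y)"
      and neq: "{u, v} \<noteq> {x, y}"
    obtain a b where ab: "u = f a" "v = f b" "g u = a" "g v = b" "(a, b) \<in> parcs G"
      using edge e by blast
    obtain c h where ch: "x = f c" "y = f h" "g x = c" "g y = h" "(c, h) \<in> parcs G"
      using edge e' by blast
    have "{a, b} \<noteq> {c, h}" using neq ab ch by auto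
    then have "path_image (\<gamma> {a, b}) \<inter> path_image (\<gamma> {c, h}) \<subseteq> p ` ({a, b} \<inter> {c, h})"
      using d[unfolded plane_drawing_def, THEN conjunct2, THEN conjunct2, THEN bspec, OF ab(5),
          unfolded prod.case, THEN bspec, OF ch(5)] by (simp only: prod.case simp_thms)
    \<comment> \<open>An image of an intersection can be too small in general; here a common end
      \<open>k\<close> comes from \<open>f k\<close>, which lies on both renamed edges.\<close>
    moreover have "{a, b} \<inter> {c, h} \<subseteq> g ` ({u, v} \<inter> {x, y})"
    proof
      fix k assume "k \<in> {a, b} \<inter> {c, h}"
      then have "f k \<in> {u, v} \<inter> {x, y}" "k = g (f k)" using ab ch by auto
      then show "k \<in> g ` ({u, v} \<inter> {x, y})" by (rule rev_image_eqI)
    qed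
    ultimately show "path_image (\<gamma> (g ` {u, v})) \<inter> path_image (\<gamma> (g ` {x, y})) \<subseteq> (p \<circ> g) ` ({u, v} \<inter> {x, y})"
      using ab(3,4) ch(3,4) by (simp only: image_insert image_empty image_comp[symmetric]) blast
  qed
  then show ?thesis unfolding planar_def by (intro exI)
qed

text \<open>The ball estimates ask for the bound at every \<open>w\<close>, vertex or not: outside
  the image of \<open>f\<close> there are no outgoing arcs, and at \<open>f v\<close> the
  out-neighbours come from arcs leaving \<open>v\<close>.\<close>

lemma card_out_relabel:
  assumes "\<And>v. v \<in> pverts G \<Longrightarrow> out_degree (with_proj G) v \<le> \<Delta>"
  shows "card (parcs (relabel f G) `` {w}) \<le> \<Delta>"
proof (cases "w \<in> f ` pverts G")
  case True
  then obtain v where v: "v \<in> pverts G" "w = f v" by blast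
  have "parcs (relabel f G) `` {w} \<subseteq> (f \<circ> snd) ` out_arcs (with_proj G) v"
  proof
    fix x assume "x \<in> parcs (relabel f G) `` {w}"
    then obtain a b where ab: "(a, b) \<in> parcs G" "f v = f a" "x = f b" using v(2) by auto
    then have "a = v" using inj v(1) by (auto dest: in_arcsD1 inj_onD)
    with ab show "x \<in> (f \<circ> snd) ` out_arcs (with_proj G) v" by (force simp: out_arcs_def)
  qed
  then have "card (parcs (relabel f G) `` {w}) \<le> card (out_arcs (with_proj G) v)"
    by (rule surj_card_le[OF finite_out_arcs])
  also have "\<dots> \<le> \<Delta>" using assms[OF v(1)] by (simp add: out_degree_def)
  finally show ?thesis .
next
  case False
  then have "parcs (relabel f G) `` {w} = {}" by (auto dest: in_arcsD1)
  then show ?thesis by simp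
qed

text \<open>Colorings are pulled back along \<open>f\<close>, injectively since every renamed vertex
  is a value of \<open>f\<close>. This direction carries a lower bound back to
  \<open>G\<close>.\<close>

lemma card_three_colorings_relabel:
  "card (three_colorings (relabel f G)) \<le> card (three_colorings G)"
proof (rule card_inj_on_le)
  let ?r = "\<lambda>c. restrict (c \<circ> f) (pverts G)"
  show "inj_on ?r (three_colorings (relabel f G))"
  proof (rule inj_onI)
    fix c c' assume c: "c \<in> three_colorings (relabel f G)" "c' \<in> three_colorings (relabel f G)"
      and eq: "?r c = ?r c'"
    show "c = c'"
    proof (rule PiE_ext)
      show "c \<in> f ` pverts G \<rightarrow>\<^sub>E {1, 2, 3}" "c' \<in> f ` pverts G \<rightarrow>\<^sub>E {1, 2, 3}"
        using c by (auto simp: three_colorings_def)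
      show "c x = c' x" if x: "x \<in> f ` pverts G" for x
      proof -
        obtain y where y: "y \<in> pverts G" "x = f y" using x by blast
        then show ?thesis using fun_cong[OF eq, of y] by simp
      qed
    qed
  qed
  show "?r ` three_colorings (relabel f G) \<subseteq> three_colorings G"
  proof
    fix d assume "d \<in> ?r ` three_colorings (relabel f G)"
    then obtain c where d: "d = ?r c" and "c \<in> three_colorings (relabel f G)" by blast
    then have c: "c \<in> f ` pverts G \<rightarrow>\<^sub>E {1, 2, 3}"
      and proper: "\<And>u v. (u, v) \<in> parcs (relabel f G) \<Longrightarrow> c u \<noteq> c v"
      unfolding three_colorings_def by auto
    have "d \<in> pverts G \<rightarrow>\<^sub>E {1, 2, 3}" unfolding d using c by (auto simp: PiE_iff)
    moreover have "d u \<noteq> d v" if "(u, v) \<in> parcs G" for u v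
      unfolding d using that proper[of "f u" "f v"] in_arcsD1[OF that] in_arcsD2[OF that]
      by (auto simp: relabel_arc_iff simp del: relabel_simps)
    ultimately show "d \<in> three_colorings G" by (auto simp: three_colorings_def)
  qed
  show "finite (three_colorings G)"
    using pair_finite_verts by (rule finite_three_colorings)
qed

end

text \<open>A finite vertex set embeds into the naturals, so the count for \<open>nat\<close>
  applies to a renamed copy of \<open>G\<close>. The assumption \<open>\<Delta> \<ge> 2\<close>
  excludes a single edge with \<open>\<Delta> = 1\<close>, which has 6 colorings while the bound
  would be 9.\<close>

theorem corollary1p3:
  fixes D :: real and G :: "'a pair_pre_digraph" and n \<Delta> :: nat
  assumes "D \<ge> 0"
    and "precoloring_extension_const D"
    and "pair_graph G" and "planar G" and "triangle_free G"
    and "card (pverts G) = n"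
    and "\<And>v. v \<in> pverts G \<Longrightarrow> out_degree (with_proj G) v \<le> \<Delta>"
    and "\<Delta> \<ge> 2"
  shows "real (card (three_colorings G)) \<ge> (3 powr (1 / (real \<Delta> powr D))) ^ n"
proof -
  interpret pair_graph G by (rule assms(3))
  obtain f :: "'a \<Rightarrow> nat" where inj: "inj_on f (pverts G)"
    using finite_imp_inj_to_nat_seg[OF pair_finite_verts] by (elim exE conjE) (rule that)
  have "(3 powr (1 / (real \<Delta> powr D))) ^ card (pverts (relabel f G))
      \<le> real (card (three_colorings (relabel f G)))"
    using card_three_colorings_nat[OF assms(2) pair_graph_relabel[OF assms(3) inj]
        planar_relabel[OF assms(3) inj assms(4)] triangle_free_relabel[OF assms(3) inj assms(5)]
        card_out_relabel[OF assms(3) inj assms(7)] assms(8)] .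
  also have "\<dots> \<le> real (card (three_colorings G))"
    using card_three_colorings_relabel[OF \<open>pair_graph G\<close> inj] by simp
  also have "card (pverts (relabel f G)) = n"
    using \<open>card (pverts G) = n\<close> inj by (simp add: card_image)
  finally show ?thesis .
qed

end
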